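(* Let $(\mathcal B,\langle\!\langle-\rangle\!\rangle,\mathcal T)$ be a $\mathcal T$-shadowed bicategory equipped with $G$-twisting data, let $g\in G$, and let ${}^g\langle\!\langle-\rangle\!\rangle$ denote the induced $g$-twisted shadow on $\mathcal B^{G\text{-tw}}$. If $R$ and $S$ are $G$-Morita equivalent, then ${}^g\langle\!\langle U_R\rangle\!\rangle\cong{}^g\langle\!\langle U_S\rangle\!\rangle$.
   Context: **Bicategories.** For 1-cells $M\colon A\to B$, $N\colon B\to C$ the horizontal composite is written $M\odot N\colon A\to C$ (first $M$, then $N$); $U_A$ is the unit 1-cell; associators and unitors $\mathfrak a,\mathfrak l,\mathfrak r$ are suppressed where harmless. $\mathrm{Pic}_{\mathcal B}(A)$ is the monoidal groupoid (under $\odot$) of invertible 1-cells $A\to A$ and invertible 2-cells. **$G$-twisting data** ($G$ a group): for each 0-cell $A$ a strong monoidal functor $\Theta_A\colon G\to\mathrm{Pic}_{\mathcal B}(A)$ with structure 2-cells $\mu^A_{g,h}\colon\Theta_A(g)\odot\Theta_A(h)\Rightarrow\Theta_A(gh)$, $\eta^A\colon U_A\Rightarrow\Theta_A(e)$. For $M\colon A\to B$: ${}^gM=\Theta_A(g^{-1})\odot M$; ${}^gf=\mathrm{id}\odot f$ for a 2-cell $f$. **Bicategory of $G$-twists $\mathcal B^{G\text{-tw}}$.** Same 0-cells. A 1-cell $A\to B$ is $(M,\tau)$ with $M\colon A\to B$ in $\mathcal B$ and invertible 2-cells $\tau_g\colon\Theta_A(g)\odot M\Rightarrow M\odot\Theta_B(g)$,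 $g\in G$, such that $\tau_e$ is the canonical isomorphism given by $\eta^A,\eta^B$ and unitors, and $\tau_{gh}=(\mathrm{id}_M\odot\mu^B_{g,h})(\tau_g\odot\mathrm{id})(\mathrm{id}\odot\tau_h)((\mu^A_{g,h})^{-1}\odot\mathrm{id}_M)$. A 2-cell $(M,\tau)\Rightarrow(N,\sigma)$ is a 2-cell $f\colon M\Rightarrow N$ with $\sigma_g(\mathrm{id}\odot f)=(f\odot\mathrm{id})\tau_g$ for all $g$. Composite: $(M\odot N,\tau\star\sigma)$, $(\tau\star\sigma)_g=(\mathrm{id}_M\odot\sigma_g)(\tau_g\odot\mathrm{id}_N)$. Unit: $U_A$ with $\mathfrak l^{-1}\mathfrak r$. **Shadows.** A $\mathcal T$-shadow on $\mathcal B$ is a family of functors $\langle\!\langle-\rangle\!\rangle_R\colon\mathcal B(R,R)\to\mathcal T$ with natural isomorphisms $\theta_{M,N}\colon\langle\!\langle M\odot N\rangle\!\rangle_R\cong\langle\!\langle N\odot M\rangle\!\rangle_S$ ($M\colon R\to S$, $N\colon S\to R$) such that, up to associators, $\theta_{M\odot N,P}=\theta_{N,P\odot M}\circ\theta_{M,N\odot P}$, and $\langle\!\langle\mathfrak l\rangle\!\rangle\circ\theta_{M,U_R}=\langle\!\langle\mathfrak r\rangle\!\rangle$, $\langle\!\langle\mathfrak r\rangle\!\rangle\circ\theta_{U_R,M}=\langle\!\langle\mathfrak l\rangle\!\rangle$. The induced $g$-twisted shadow is ${}^g\langle\!\langle(M,\tau)\rangle\!\rangle_R=\langle\!\langle{}^gM\rangle\!\rangle_R$,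 ${}^g\langle\!\langle f\rangle\!\rangle_R=\langle\!\langle{}^gf\rangle\!\rangle_R$. **$G$-Morita equivalence.** 0-cells $R,S$ are $G$-Morita equivalent if there are 1-cells $M\in\mathcal B^{G\text{-tw}}(R,S)$, $N\in\mathcal B^{G\text{-tw}}(S,R)$ and invertible 2-cells $\bar\eta\colon U_S\cong N\odot M$, $\bar\epsilon\colon M\odot N\cong U_R$ in $\mathcal B^{G\text{-tw}}$ satisfying the triangle identities $(\bar\epsilon\odot\mathrm{id}_M)(\mathrm{id}_M\odot\bar\eta)=\mathrm{id}_M$, $(\mathrm{id}_N\odot\bar\epsilon)(\bar\eta\odot\mathrm{id}_N)=\mathrm{id}_N$. *)

theory Defs
  imports "HOL-Algebra.Group"
begin

text \<open>Hom-sets are indexed by their end points and need not be disjoint; composition is in the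
  applicative order, so \<open>Comp C g f\<close> is \<open>g\<close> after \<open>f\<close>.\<close>

record ('x, 'y) cat =
  Ob :: "'x set"
  Mor :: "'x \<Rightarrow> 'x \<Rightarrow> 'y set"
  Id :: "'x \<Rightarrow> 'y"
  Comp :: "'y \<Rightarrow> 'y \<Rightarrow> 'y" (infixr "\<star>\<index>" 55)

locale category =
  fixes C :: "('x, 'y) cat" (structure)
  assumes Id_mor: "X \<in> Ob C \<Longrightarrow> Id C X \<in> Mor C X X"
    and Comp_mor: "\<lbrakk>X \<in> Ob C; Y \<in> Ob C; Z \<in> Ob C; f \<in> Mor C X Y; g \<in> Mor C Y Z\<rbrakk>
      \<Longrightarrow> g \<star> f \<in> Mor C X Z"
    and Comp_Id: "\<lbrakk>X \<in> Ob C; Y \<in> Ob C; f \<in> Mor C X Y\<rbrakk> \<Longrightarrow> f \<star> Id C X = f"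
    and Id_Comp: "\<lbrakk>X \<in> Ob C; Y \<in> Ob C; f \<in> Mor C X Y\<rbrakk> \<Longrightarrow> Id C Y \<star> f = f"
    and Comp_assoc: "\<lbrakk>X \<in> Ob C; Y \<in> Ob C; Z \<in> Ob C; W \<in> Ob C;
        f \<in> Mor C X Y; g \<in> Mor C Y Z; h \<in> Mor C Z W\<rbrakk> \<Longrightarrow> (h \<star> g) \<star> f = h \<star> (g \<star> f)"

definition is_inverse :: "('x, 'y) cat \<Rightarrow> 'x \<Rightarrow> 'x \<Rightarrow> 'y \<Rightarrow> 'y \<Rightarrow> bool" where
  "is_inverse C X Y f g \<longleftrightarrow> f \<in> Mor C X Y \<and> g \<in> Mor C Y X \<and>
     g \<star>\<^bsub>C\<^esub> f = Id C X \<and> f \<star>\<^bsub>C\<^esub> g = Id C Y"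

definition isos :: "('x, 'y) cat \<Rightarrow> 'x \<Rightarrow> 'x \<Rightarrow> 'y set" where
  "isos C X Y = {f. \<exists>g. is_inverse C X Y f g}"

definition inverse_mor :: "('x, 'y) cat \<Rightarrow> 'x \<Rightarrow> 'x \<Rightarrow> 'y \<Rightarrow> 'y" where
  "inverse_mor C X Y f = (THE g. is_inverse C X Y f g)"

definition isomorphic :: "('x, 'y) cat \<Rightarrow> 'x \<Rightarrow> 'x \<Rightarrow> bool" where
  "isomorphic C X Y \<longleftrightarrow> X \<in> Ob C \<and> Y \<in> Ob C \<and> isos C X Y \<noteq> {}"

record ('x, 'y, 'u, 'v) ftor =
  on_ob :: "'x \<Rightarrow> 'u"
  on_mor :: "'y \<Rightarrow> 'v"

definition is_functor :: "('x, 'y) cat \<Rightarrow> ('u, 'v) cat \<Rightarrow> ('x, 'y, 'u, 'v) ftor \<Rightarrow> bool" where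
  "is_functor C D F \<longleftrightarrow>
     (\<forall>X\<in>Ob C. on_ob F X \<in> Ob D) \<and>
     (\<forall>X\<in>Ob C. \<forall>Y\<in>Ob C. \<forall>f\<in>Mor C X Y. on_mor F f \<in> Mor D (on_ob F X) (on_ob F Y)) \<and>
     (\<forall>X\<in>Ob C. on_mor F (Id C X) = Id D (on_ob F X)) \<and>
     (\<forall>X\<in>Ob C. \<forall>Y\<in>Ob C. \<forall>Z\<in>Ob C. \<forall>f\<in>Mor C X Y. \<forall>g\<in>Mor C Y Z.
        on_mor F (g \<star>\<^bsub>C\<^esub> f) = on_mor F g \<star>\<^bsub>D\<^esub> on_mor F f)"

text \<open>\<open>M \<odot> N\<close> and \<open>f \<ostar> h\<close> are the horizontal composites of 1-cells and of 2-cells in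
  diagrammatic order (first \<open>M\<close>, then \<open>N\<close>); \<open>g \<cdot> f\<close> is the vertical composite \<open>g\<close> after \<open>f\<close>.
  A 1-cell determines its source and target, whereas the sets \<open>cells2 B M N\<close> (meaningful for
  parallel \<open>M\<close> and \<open>N\<close>) need not be disjoint.\<close>

record ('o, 'm, 'c) bicat =
  cells0 :: "'o set"
  cells1 :: "'m set"
  src :: "'m \<Rightarrow> 'o"
  tgt :: "'m \<Rightarrow> 'o"
  cells2 :: "'m \<Rightarrow> 'm \<Rightarrow> 'c set"
  ident :: "'m \<Rightarrow> 'c" ("\<ii>\<index>")
  vcomp :: "'c \<Rightarrow> 'c \<Rightarrow> 'c" (infixr "\<cdot>\<index>" 55)
  unit1 :: "'o \<Rightarrow> 'm" ("\<U>\<index>")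
  hcomp :: "'m \<Rightarrow> 'm \<Rightarrow> 'm" (infixl "\<odot>\<index>" 70)
  hcomp2 :: "'c \<Rightarrow> 'c \<Rightarrow> 'c" (infixl "\<ostar>\<index>" 70)
  assoc :: "'m \<Rightarrow> 'm \<Rightarrow> 'm \<Rightarrow> 'c" ("\<aa>\<index>")
  lunit :: "'m \<Rightarrow> 'c" ("\<ll>\<index>")
  runit :: "'m \<Rightarrow> 'c" ("\<rr>\<index>")

definition arr :: "('o, 'm, 'c) bicat \<Rightarrow> 'o \<Rightarrow> 'o \<Rightarrow> 'm set" where
  "arr B X Y = {M \<in> cells1 B. src B M = X \<and> tgt B M = Y}"

definition hom_cat :: "('o, 'm, 'c) bicat \<Rightarrow> 'o \<Rightarrow> 'o \<Rightarrow> ('m, 'c) cat" where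
  "hom_cat B X Y = \<lparr>Ob = arr B X Y, Mor = cells2 B, Id = ident B, Comp = vcomp B\<rparr>"

definition isos2 :: "('o, 'm, 'c) bicat \<Rightarrow> 'm \<Rightarrow> 'm \<Rightarrow> 'c set" where
  "isos2 B M N = isos (hom_cat B (src B M) (tgt B M)) M N"

definition inv2 :: "('o, 'm, 'c) bicat \<Rightarrow> 'm \<Rightarrow> 'm \<Rightarrow> 'c \<Rightarrow> 'c" where
  "inv2 B M N f = inverse_mor (hom_cat B (src B M) (tgt B M)) M N f"

definition assoc_inv :: "('o, 'm, 'c) bicat \<Rightarrow> 'm \<Rightarrow> 'm \<Rightarrow> 'm \<Rightarrow> 'c" ("\<aa>inv\<index>") where
  "assoc_inv B M N P =
     inv2 B ((M \<odot>\<^bsub>B\<^esub> N) \<odot>\<^bsub>B\<^esub> P) (M \<odot>\<^bsub>B\<^esub> (N \<odot>\<^bsub>B\<^esub> P)) (assoc B M N P)"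

definition lunit_inv :: "('o, 'm, 'c) bicat \<Rightarrow> 'm \<Rightarrow> 'c" ("\<ll>inv\<index>") where
  "lunit_inv B M = inv2 B (unit1 B (src B M) \<odot>\<^bsub>B\<^esub> M) M (lunit B M)"

definition runit_inv :: "('o, 'm, 'c) bicat \<Rightarrow> 'm \<Rightarrow> 'c" ("\<rr>inv\<index>") where
  "runit_inv B M = inv2 B (M \<odot>\<^bsub>B\<^esub> unit1 B (tgt B M)) M (runit B M)"

locale bicategory =
  fixes B :: "('o, 'm, 'c) bicat" (structure)
  assumes src_tgt: "M \<in> cells1 B \<Longrightarrow> src B M \<in> cells0 B \<and> tgt B M \<in> cells0 B"
    and hom_category: "\<lbrakk>X \<in> cells0 B; Y \<in> cells0 B\<rbrakk> \<Longrightarrow> category (hom_cat B X Y)"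
    and unit_arr: "X \<in> cells0 B \<Longrightarrow> \<U> X \<in> arr B X X"
    and hcomp_arr: "\<lbrakk>M \<in> arr B X Y; N \<in> arr B Y Z\<rbrakk> \<Longrightarrow> M \<odot> N \<in> arr B X Z"
    and hcomp2_cell: "\<lbrakk>M \<in> arr B X Y; M' \<in> arr B X Y; N \<in> arr B Y Z; N' \<in> arr B Y Z;
        f \<in> cells2 B M M'; h \<in> cells2 B N N'\<rbrakk>
      \<Longrightarrow> f \<ostar> h \<in> cells2 B (M \<odot> N) (M' \<odot> N')"
    and hcomp2_ident: "\<lbrakk>M \<in> arr B X Y; N \<in> arr B Y Z\<rbrakk> \<Longrightarrow> \<ii> M \<ostar> \<ii> N = \<ii> (M \<odot> N)"
    and interchange: "\<lbrakk>M \<in> arr B X Y; M' \<in> arr B X Y; M'' \<in> arr B X Y;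
        N \<in> arr B Y Z; N' \<in> arr B Y Z; N'' \<in> arr B Y Z;
        f \<in> cells2 B M M'; f' \<in> cells2 B M' M''; h \<in> cells2 B N N'; h' \<in> cells2 B N' N''\<rbrakk>
      \<Longrightarrow> (f' \<cdot> f) \<ostar> (h' \<cdot> h) = (f' \<ostar> h') \<cdot> (f \<ostar> h)"
    and assoc_iso: "\<lbrakk>M \<in> arr B X Y; N \<in> arr B Y Z; P \<in> arr B Z W\<rbrakk>
      \<Longrightarrow> \<aa> M N P \<in> isos2 B ((M \<odot> N) \<odot> P) (M \<odot> (N \<odot> P))"
    and assoc_natural: "\<lbrakk>M \<in> arr B X Y; M' \<in> arr B X Y; N \<in> arr B Y Z; N' \<in> arr B Y Z;
        P \<in> arr B Z W; P' \<in> arr B Z W;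
        f \<in> cells2 B M M'; h \<in> cells2 B N N'; k \<in> cells2 B P P'\<rbrakk>
      \<Longrightarrow> \<aa> M' N' P' \<cdot> ((f \<ostar> h) \<ostar> k) = (f \<ostar> (h \<ostar> k)) \<cdot> \<aa> M N P"
    and lunit_iso: "M \<in> arr B X Y \<Longrightarrow> \<ll> M \<in> isos2 B (\<U> X \<odot> M) M"
    and lunit_natural: "\<lbrakk>M \<in> arr B X Y; M' \<in> arr B X Y; f \<in> cells2 B M M'\<rbrakk>
      \<Longrightarrow> \<ll> M' \<cdot> (\<ii> (\<U> X) \<ostar> f) = f \<cdot> \<ll> M"
    and runit_iso: "M \<in> arr B X Y \<Longrightarrow> \<rr> M \<in> isos2 B (M \<odot> \<U> Y) M"
    and runit_natural: "\<lbrakk>M \<in> arr B X Y; M' \<in> arr B X Y; f \<in> cells2 B M M'\<rbrakk>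
      \<Longrightarrow> \<rr> M' \<cdot> (f \<ostar> \<ii> (\<U> Y)) = f \<cdot> \<rr> M"
    and pentagon: "\<lbrakk>M \<in> arr B X Y; N \<in> arr B Y Z; P \<in> arr B Z W; Q \<in> arr B W V\<rbrakk>
      \<Longrightarrow> \<aa> M N (P \<odot> Q) \<cdot> \<aa> (M \<odot> N) P Q
        = (\<ii> M \<ostar> \<aa> N P Q) \<cdot> \<aa> M (N \<odot> P) Q \<cdot> (\<aa> M N P \<ostar> \<ii> Q)"
    and triangle: "\<lbrakk>M \<in> arr B X Y; N \<in> arr B Y Z\<rbrakk>
      \<Longrightarrow> (\<ii> M \<ostar> \<ll> N) \<cdot> \<aa> M (\<U> Y) N = \<rr> M \<ostar> \<ii> N"

text \<open>Equivalence of 0-cells through a dual pair with invertible unit and counit; the equations are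
  the triangle identities with the suppressed associators and unitors written out.\<close>

definition morita_equivalent :: "('o, 'm, 'c) bicat \<Rightarrow> 'o \<Rightarrow> 'o \<Rightarrow> bool" where
  "morita_equivalent B R S \<longleftrightarrow>
     (\<exists>M\<in>arr B R S. \<exists>N\<in>arr B S R.
      \<exists>eta \<in> isos2 B (unit1 B S) (N \<odot>\<^bsub>B\<^esub> M). \<exists>eps \<in> isos2 B (M \<odot>\<^bsub>B\<^esub> N) (unit1 B R).
        \<ll>\<^bsub>B\<^esub> M \<cdot>\<^bsub>B\<^esub> (eps \<ostar>\<^bsub>B\<^esub> \<ii>\<^bsub>B\<^esub> M) \<cdot>\<^bsub>B\<^esub> \<aa>inv\<^bsub>B\<^esub> M N M \<cdot>\<^bsub>B\<^esub> (\<ii>\<^bsub>B\<^esub> M \<ostar>\<^bsub>B\<^esub> eta) \<cdot>\<^bsub>B\<^esub> \<rr>inv\<^bsub>B\<^esub> M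
          = \<ii>\<^bsub>B\<^esub> M \<and>
        \<rr>\<^bsub>B\<^esub> N \<cdot>\<^bsub>B\<^esub> (\<ii>\<^bsub>B\<^esub> N \<ostar>\<^bsub>B\<^esub> eps) \<cdot>\<^bsub>B\<^esub> \<aa>\<^bsub>B\<^esub> N M N \<cdot>\<^bsub>B\<^esub> (eta \<ostar>\<^bsub>B\<^esub> \<ii>\<^bsub>B\<^esub> N) \<cdot>\<^bsub>B\<^esub> \<ll>inv\<^bsub>B\<^esub> N
          = \<ii>\<^bsub>B\<^esub> N)"

record ('o, 'm, 'c, 'x, 'y) shadow =
  sh :: "'o \<Rightarrow> ('m, 'c, 'x, 'y) ftor"
  theta :: "'m \<Rightarrow> 'm \<Rightarrow> 'y"

abbreviation sh_ob :: "('o, 'm, 'c, 'x, 'y) shadow \<Rightarrow> 'o \<Rightarrow> 'm \<Rightarrow> 'x" where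
  "sh_ob Sh R M \<equiv> on_ob (sh Sh R) M"

abbreviation sh_mor :: "('o, 'm, 'c, 'x, 'y) shadow \<Rightarrow> 'o \<Rightarrow> 'c \<Rightarrow> 'y" where
  "sh_mor Sh R f \<equiv> on_mor (sh Sh R) f"

locale shadowed_bicategory = bicategory B + T: category T
  for B :: "('o, 'm, 'c) bicat" (structure) and T :: "('x, 'y) cat" +
  fixes Sh :: "('o, 'm, 'c, 'x, 'y) shadow"
  assumes sh_functor: "R \<in> cells0 B \<Longrightarrow> is_functor (hom_cat B R R) T (sh Sh R)"
    and theta_iso: "\<lbrakk>M \<in> arr B R S; N \<in> arr B S R\<rbrakk>
      \<Longrightarrow> theta Sh M N \<in> isos T (sh_ob Sh R (M \<odot> N)) (sh_ob Sh S (N \<odot> M))"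
    and theta_natural: "\<lbrakk>M \<in> arr B R S; M' \<in> arr B R S; N \<in> arr B S R; N' \<in> arr B S R;
        f \<in> cells2 B M M'; h \<in> cells2 B N N'\<rbrakk>
      \<Longrightarrow> theta Sh M' N' \<star>\<^bsub>T\<^esub> sh_mor Sh R (f \<ostar> h) = sh_mor Sh S (h \<ostar> f) \<star>\<^bsub>T\<^esub> theta Sh M N"
    and theta_hcomp: "\<lbrakk>M \<in> arr B R S; N \<in> arr B S Q; P \<in> arr B Q R\<rbrakk>
      \<Longrightarrow> theta Sh (M \<odot> N) P =
          sh_mor Sh Q (\<aa> P M N) \<star>\<^bsub>T\<^esub> theta Sh N (P \<odot> M) \<star>\<^bsub>T\<^esub>
          sh_mor Sh S (\<aa> N P M) \<star>\<^bsub>T\<^esub> theta Sh M (N \<odot> P) \<star>\<^bsub>T\<^esub> sh_mor Sh R (\<aa> M N P)"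
    and theta_unit_right: "M \<in> arr B R R
      \<Longrightarrow> sh_mor Sh R (\<ll> M) \<star>\<^bsub>T\<^esub> theta Sh M (\<U> R) = sh_mor Sh R (\<rr> M)"
    and theta_unit_left: "M \<in> arr B R R
      \<Longrightarrow> sh_mor Sh R (\<rr> M) \<star>\<^bsub>T\<^esub> theta Sh (\<U> R) M = sh_mor Sh R (\<ll> M)"

text \<open>The monoidal structure of the Picard groupoid \<open>Pic B X\<close> is inherited from \<open>B\<close>.\<close>

definition invertible_arr :: "('o, 'm, 'c) bicat \<Rightarrow> 'o \<Rightarrow> 'm \<Rightarrow> bool" where
  "invertible_arr B X M \<longleftrightarrow> M \<in> arr B X X \<and>
     (\<exists>N\<in>arr B X X. isos2 B (M \<odot>\<^bsub>B\<^esub> N) (unit1 B X) \<noteq> {} \<and> isos2 B (N \<odot>\<^bsub>B\<^esub> M) (unit1 B X) \<noteq> {})"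

definition Pic :: "('o, 'm, 'c) bicat \<Rightarrow> 'o \<Rightarrow> ('m, 'c) cat" where
  "Pic B X = \<lparr>Ob = {M. invertible_arr B X M}, Mor = isos2 B, Id = ident B, Comp = vcomp B\<rparr>"

record ('o, 'g, 'm, 'c) twisting =
  Theta :: "'o \<Rightarrow> 'g \<Rightarrow> 'm"
  mu :: "'o \<Rightarrow> 'g \<Rightarrow> 'g \<Rightarrow> 'c"
  eta :: "'o \<Rightarrow> 'c"

text \<open>For each 0-cell \<open>X\<close>, a strong monoidal functor from \<open>G\<close>, regarded as a discrete monoidal
  category, to \<open>Pic B X\<close>. Discreteness makes the action on morphisms and the naturality of \<open>mu\<close>
  vacuous, so only the object map, the structure 2-cells and their coherence remain.\<close>

locale twisting_data = bicategory B + G: group G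
  for B :: "('o, 'm, 'c) bicat" (structure) and G :: "'g monoid" +
  fixes D :: "('o, 'g, 'm, 'c) twisting"
  assumes Theta_Pic: "\<lbrakk>X \<in> cells0 B; g \<in> carrier G\<rbrakk> \<Longrightarrow> Theta D X g \<in> Ob (Pic B X)"
    and mu_Pic: "\<lbrakk>X \<in> cells0 B; g \<in> carrier G; h \<in> carrier G\<rbrakk>
      \<Longrightarrow> mu D X g h \<in> Mor (Pic B X) (Theta D X g \<odot> Theta D X h) (Theta D X (g \<otimes>\<^bsub>G\<^esub> h))"
    and eta_Pic: "X \<in> cells0 B \<Longrightarrow> eta D X \<in> Mor (Pic B X) (\<U> X) (Theta D X \<one>\<^bsub>G\<^esub>)"
    and mu_assoc: "\<lbrakk>X \<in> cells0 B; g \<in> carrier G; h \<in> carrier G; k \<in> carrier G\<rbrakk>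
      \<Longrightarrow> mu D X (g \<otimes>\<^bsub>G\<^esub> h) k \<cdot> (mu D X g h \<ostar> \<ii> (Theta D X k))
        = mu D X g (h \<otimes>\<^bsub>G\<^esub> k) \<cdot> (\<ii> (Theta D X g) \<ostar> mu D X h k)
            \<cdot> \<aa> (Theta D X g) (Theta D X h) (Theta D X k)"
    and mu_unit_left: "\<lbrakk>X \<in> cells0 B; g \<in> carrier G\<rbrakk>
      \<Longrightarrow> mu D X \<one>\<^bsub>G\<^esub> g \<cdot> (eta D X \<ostar> \<ii> (Theta D X g)) = \<ll> (Theta D X g)"
    and mu_unit_right: "\<lbrakk>X \<in> cells0 B; g \<in> carrier G\<rbrakk>
      \<Longrightarrow> mu D X g \<one>\<^bsub>G\<^esub> \<cdot> (\<ii> (Theta D X g) \<ostar> eta D X) = \<rr> (Theta D X g)"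

text \<open>The canonical value at \<open>\<one>\<close> is the composite
  \<open>\<Theta>\<^sub>X(\<one>) \<odot> M \<Rightarrow> \<U>\<^sub>X \<odot> M \<Rightarrow> M \<Rightarrow> M \<odot> \<U>\<^sub>Y \<Rightarrow> M \<odot> \<Theta>\<^sub>Y(\<one>)\<close>. The long composites below are
  the usual coherence formulas with the suppressed associators inserted.\<close>

context
  fixes B :: "('o, 'm, 'c) bicat" (structure)
    and G :: "'g monoid"
    and D :: "('o, 'g, 'm, 'c) twisting"
begin

definition tw_unit_condition :: "'m \<Rightarrow> ('g \<Rightarrow> 'c) \<Rightarrow> bool" where
  "tw_unit_condition M \<tau> \<longleftrightarrow>
     (let X = src B M; Y = tgt B M in
      \<tau> \<one>\<^bsub>G\<^esub> = (\<ii> M \<ostar> eta D Y) \<cdot> \<rr>inv M \<cdot> \<ll> M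
               \<cdot> (inv2 B (\<U> X) (Theta D X \<one>\<^bsub>G\<^esub>) (eta D X) \<ostar> \<ii> M))"

definition tw_mult_condition :: "'m \<Rightarrow> ('g \<Rightarrow> 'c) \<Rightarrow> bool" where
  "tw_mult_condition M \<tau> \<longleftrightarrow>
     (let X = src B M; Y = tgt B M in
      \<forall>g\<in>carrier G. \<forall>h\<in>carrier G.
        \<tau> (g \<otimes>\<^bsub>G\<^esub> h) =
          (\<ii> M \<ostar> mu D Y g h)
          \<cdot> \<aa> M (Theta D Y g) (Theta D Y h)
          \<cdot> (\<tau> g \<ostar> \<ii> (Theta D Y h))
          \<cdot> \<aa>inv (Theta D X g) M (Theta D Y h)
          \<cdot> (\<ii> (Theta D X g) \<ostar> \<tau> h)
          \<cdot> \<aa> (Theta D X g) (Theta D X h) M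
          \<cdot> (inv2 B (Theta D X g \<odot> Theta D X h) (Theta D X (g \<otimes>\<^bsub>G\<^esub> h)) (mu D X g h) \<ostar> \<ii> M))"

text \<open>The family \<open>\<tau>\<close> is indexed by \<open>carrier G\<close>; extensionality fixes its irrelevant values.\<close>

definition tw_cells1 :: "('m \<times> ('g \<Rightarrow> 'c)) set" where
  "tw_cells1 = {(M, \<tau>). M \<in> cells1 B \<and> \<tau> \<in> extensional (carrier G) \<and>
     (\<forall>g\<in>carrier G. \<tau> g \<in> isos2 B (Theta D (src B M) g \<odot> M) (M \<odot> Theta D (tgt B M) g)) \<and>
     tw_unit_condition M \<tau> \<and> tw_mult_condition M \<tau>}"

definition tw_cells2 :: "'m \<times> ('g \<Rightarrow> 'c) \<Rightarrow> 'm \<times> ('g \<Rightarrow> 'c) \<Rightarrow> 'c set" where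
  "tw_cells2 = (\<lambda>(M, \<tau>) (N, \<sigma>). {f \<in> cells2 B M N. \<forall>g\<in>carrier G.
     \<sigma> g \<cdot> (\<ii> (Theta D (src B M) g) \<ostar> f) = (f \<ostar> \<ii> (Theta D (tgt B M) g)) \<cdot> \<tau> g})"

definition tw_unit :: "'o \<Rightarrow> 'm \<times> ('g \<Rightarrow> 'c)" where
  "tw_unit X = (\<U> X, \<lambda>g\<in>carrier G. \<ll>inv (Theta D X g) \<cdot> \<rr> (Theta D X g))"

definition tw_hcomp :: "'m \<times> ('g \<Rightarrow> 'c) \<Rightarrow> 'm \<times> ('g \<Rightarrow> 'c) \<Rightarrow> 'm \<times> ('g \<Rightarrow> 'c)" where
  "tw_hcomp = (\<lambda>(M, \<tau>) (N, \<sigma>).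
     let X = src B M; Y = tgt B M; Z = tgt B N in
     (M \<odot> N, \<lambda>g\<in>carrier G.
        \<aa>inv M N (Theta D Z g)
        \<cdot> (\<ii> M \<ostar> \<sigma> g)
        \<cdot> \<aa> M (Theta D Y g) N
        \<cdot> (\<tau> g \<ostar> \<ii> N)
        \<cdot> \<aa>inv (Theta D X g) M N))"

definition tw_bicat :: "('o, 'm \<times> ('g \<Rightarrow> 'c), 'c) bicat" where
  "tw_bicat =
     \<lparr>cells0 = cells0 B,
      cells1 = tw_cells1,
      src = \<lambda>(M, \<tau>). src B M,
      tgt = \<lambda>(M, \<tau>). tgt B M,
      cells2 = tw_cells2,
      ident = \<lambda>(M, \<tau>). \<ii> M,
      vcomp = vcomp B,
      unit1 = tw_unit,
      hcomp = tw_hcomp,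
      hcomp2 = hcomp2 B,
      assoc = \<lambda>(M, \<tau>) (N, \<sigma>) (P, \<rho>). \<aa> M N P,
      lunit = \<lambda>(M, \<tau>). \<ll> M,
      runit = \<lambda>(M, \<tau>). \<rr> M\<rparr>"

definition G_morita_equivalent :: "'o \<Rightarrow> 'o \<Rightarrow> bool" where
  "G_morita_equivalent R S \<longleftrightarrow> morita_equivalent tw_bicat R S"

definition twist_arr :: "'g \<Rightarrow> 'o \<Rightarrow> 'm \<Rightarrow> 'm" where
  "twist_arr g X M = Theta D X (inv\<^bsub>G\<^esub> g) \<odot> M"

definition twist_cell :: "'g \<Rightarrow> 'o \<Rightarrow> 'c \<Rightarrow> 'c" where
  "twist_cell g X f = \<ii> (Theta D X (inv\<^bsub>G\<^esub> g)) \<ostar> f"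

definition twisted_shadow ::
  "('o, 'm, 'c, 'x, 'y) shadow \<Rightarrow> 'g \<Rightarrow> 'o \<Rightarrow> ('m \<times> ('g \<Rightarrow> 'c), 'c, 'x, 'y) ftor" where
  "twisted_shadow Sh g R =
     \<lparr>on_ob = \<lambda>(M, \<tau>). sh_ob Sh R (twist_arr g R M),
      on_mor = \<lambda>f. sh_mor Sh R (twist_cell g R f)\<rparr>"

end

end

theory Submission
  imports Defs
begin

text \<open>A Morita equivalence \<open>(M, N)\<close> identifies the shadow of an endo-1-cell \<open>L\<close> of \<open>R\<close> with the
  shadow of any endo-1-cell \<open>K\<close> of \<open>S\<close> that \<open>M\<close> intertwines with it: cyclicity turns
  \<open>L \<odot> (M \<odot> N) \<cong> (M \<odot> K) \<odot> N\<close> into \<open>(N \<odot> M) \<odot> K\<close>. The twisted shadow of the unit at \<open>X\<close> is the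
  shadow of \<open>\<Theta>\<^sub>X(g\<inverse>)\<close> up to a unitor, and the component \<open>\<tau>\<close> at \<open>g\<inverse>\<close> of the twisting on \<open>M\<close> is
  exactly an intertwining isomorphism \<open>\<Theta>\<^sub>R(g\<inverse>) \<odot> M \<cong> M \<odot> \<Theta>\<^sub>S(g\<inverse>)\<close>.

  Since only the existence of an isomorphism is claimed, the argument is carried out with the
  relation \<open>isomorphic\<close>: it is an equivalence relation, preserved by functors and by horizontal
  composition.\<close>

context category
begin

lemma isomorphic_refl: "X \<in> Ob C \<Longrightarrow> isomorphic C X X"
  unfolding isomorphic_def isos_def is_inverse_def
  using Id_mor Comp_Id by blast

lemma isomorphic_sym: "isomorphic C X Y \<Longrightarrow> isomorphic C Y X"
  unfolding isomorphic_def isos_def is_inverse_def by blast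

lemma inverse_comp:
  assumes "X \<in> Ob C" "Y \<in> Ob C" "Z \<in> Ob C"
    and f: "is_inverse C X Y f f'" and k: "is_inverse C Y Z k k'"
  shows "(f' \<star> k') \<star> (k \<star> f) = Id C X"
proof -
  have mor: "f \<in> Mor C X Y" "f' \<in> Mor C Y X" "k \<in> Mor C Y Z" "k' \<in> Mor C Z Y"
    and eq: "f' \<star> f = Id C X" "k' \<star> k = Id C Y"
    using f k by (simp_all add: is_inverse_def)
  note ob = assms(1-3)
  have "(f' \<star> k') \<star> (k \<star> f) = f' \<star> (k' \<star> (k \<star> f))"
    using Comp_assoc[OF ob(1,3,2,1) Comp_mor[OF ob mor(1,3)] mor(4,2)] .
  also have "\<dots> = f' \<star> ((k' \<star> k) \<star> f)"
    using Comp_assoc[OF ob(1,2,3,2) mor(1,3,4)] by simp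
  also have "\<dots> = Id C X"
    using Id_Comp[OF ob(1,2) mor(1)] eq by simp
  finally show ?thesis .
qed

lemma isomorphic_trans [trans]:
  assumes "isomorphic C X Y" "isomorphic C Y Z"
  shows "isomorphic C X Z"
proof -
  from assms have ob: "X \<in> Ob C" "Y \<in> Ob C" "Z \<in> Ob C"
    by (auto simp: isomorphic_def)
  from assms obtain f f' k k' where f: "is_inverse C X Y f f'" and k: "is_inverse C Y Z k k'"
    by (auto simp: isomorphic_def isos_def)
  have f': "is_inverse C Y X f' f" and k': "is_inverse C Z Y k' k"
    using f k by (auto simp: is_inverse_def)
  have "is_inverse C X Z (k \<star> f) (f' \<star> k')"
    using inverse_comp[OF ob f k] inverse_comp[OF ob(3,2,1) k' f'] f k
      Comp_mor[OF ob, of f k] Comp_mor[OF ob(3,2,1), of k' f']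
    unfolding is_inverse_def by blast
  with ob show ?thesis
    by (auto simp: isomorphic_def isos_def)
qed

end

lemma functor_isomorphic:
  assumes F: "is_functor C D F" and XY: "isomorphic C X Y"
  shows "isomorphic D (on_ob F X) (on_ob F Y)"
proof -
  from XY have ob: "X \<in> Ob C" "Y \<in> Ob C"
    by (auto simp: isomorphic_def)
  from XY obtain f f' where f: "is_inverse C X Y f f'"
    by (auto simp: isomorphic_def isos_def)
  have "is_inverse D (on_ob F X) (on_ob F Y) (on_mor F f) (on_mor F f')"
    unfolding is_inverse_def
  proof (intro conjI)
    have mor: "f \<in> Mor C X Y" "f' \<in> Mor C Y X"
      and eq: "f' \<star>\<^bsub>C\<^esub> f = Id C X" "f \<star>\<^bsub>C\<^esub> f' = Id C Y"
      using f by (simp_all add: is_inverse_def)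
    show "on_mor F f \<in> Mor D (on_ob F X) (on_ob F Y)" "on_mor F f' \<in> Mor D (on_ob F Y) (on_ob F X)"
      using F ob mor by (simp_all add: is_functor_def)
    have comp: "on_mor F (q \<star>\<^bsub>C\<^esub> p) = on_mor F q \<star>\<^bsub>D\<^esub> on_mor F p"
      if "V \<in> Ob C" "W \<in> Ob C" "p \<in> Mor C V W" "q \<in> Mor C W V" for V W p q
      using F that unfolding is_functor_def by blast
    show "on_mor F f' \<star>\<^bsub>D\<^esub> on_mor F f = Id D (on_ob F X)"
      using comp[OF ob mor] F ob eq by (simp add: is_functor_def)
    show "on_mor F f \<star>\<^bsub>D\<^esub> on_mor F f' = Id D (on_ob F Y)"
      using comp[OF ob(2,1) mor(2,1)] F ob eq by (simp add: is_functor_def)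
  qed
  moreover have "on_ob F X \<in> Ob D" "on_ob F Y \<in> Ob D"
    using F ob by (auto simp: is_functor_def)
  ultimately show ?thesis
    by (auto simp: isomorphic_def isos_def)
qed

lemma isomorphic_hom_catI:
  assumes "M \<in> arr B X Y" "N \<in> arr B X Y" "f \<in> isos2 B M N"
  shows "isomorphic (hom_cat B X Y) M N"
  using assms by (auto simp: isomorphic_def isos2_def hom_cat_def arr_def)

lemma isomorphic_hom_catE:
  assumes "isomorphic (hom_cat B X Y) M N"
  obtains f f' where "M \<in> arr B X Y" "N \<in> arr B X Y" "f \<in> cells2 B M N" "f' \<in> cells2 B N M"
    "f' \<cdot>\<^bsub>B\<^esub> f = \<ii>\<^bsub>B\<^esub> M" "f \<cdot>\<^bsub>B\<^esub> f' = \<ii>\<^bsub>B\<^esub> N"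
  using assms by (auto simp: isomorphic_def isos_def is_inverse_def hom_cat_def)

context bicategory
begin

lemma arr_cells0: "M \<in> arr B X Y \<Longrightarrow> X \<in> cells0 B \<and> Y \<in> cells0 B"
  using src_tgt by (auto simp: arr_def)

lemma isomorphic_arr_refl: "M \<in> arr B X Y \<Longrightarrow> isomorphic (hom_cat B X Y) M M"
  using category.isomorphic_refl[OF hom_category, of X Y M] arr_cells0[of M X Y]
  by (simp add: hom_cat_def)

lemma isomorphic_hcomp:
  assumes "isomorphic (hom_cat B X Y) M M'" "isomorphic (hom_cat B Y Z) N N'"
  shows "isomorphic (hom_cat B X Z) (M \<odot> N) (M' \<odot> N')"
proof -
  obtain f f' where M: "M \<in> arr B X Y" "M' \<in> arr B X Y"
    and f: "f \<in> cells2 B M M'" "f' \<in> cells2 B M' M" "f' \<cdot> f = \<ii> M" "f \<cdot> f' = \<ii> M'"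
    using assms(1) by (rule isomorphic_hom_catE)
  obtain h h' where N: "N \<in> arr B Y Z" "N' \<in> arr B Y Z"
    and h: "h \<in> cells2 B N N'" "h' \<in> cells2 B N' N" "h' \<cdot> h = \<ii> N" "h \<cdot> h' = \<ii> N'"
    using assms(2) by (rule isomorphic_hom_catE)
  have "(f' \<ostar> h') \<cdot> (f \<ostar> h) = \<ii> (M \<odot> N)"
    using interchange[OF M(1,2,1) N(1,2,1) f(1,2) h(1,2)] f h hcomp2_ident M N by simp
  moreover have "(f \<ostar> h) \<cdot> (f' \<ostar> h') = \<ii> (M' \<odot> N')"
    using interchange[OF M(2,1,2) N(2,1,2) f(2,1) h(2,1)] f h hcomp2_ident M N by simp
  ultimately have "is_inverse (hom_cat B X Z) (M \<odot> N) (M' \<odot> N') (f \<ostar> h) (f' \<ostar> h')"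
    using hcomp2_cell[OF M N f(1) h(1)] hcomp2_cell[OF M(2,1) N(2,1) f(2) h(2)]
    by (simp add: is_inverse_def hom_cat_def)
  moreover have "M \<odot> N \<in> arr B X Z" "M' \<odot> N' \<in> arr B X Z"
    using M N by (meson hcomp_arr)+
  ultimately show ?thesis
    by (auto simp: isomorphic_def isos_def hom_cat_def)
qed

lemma isomorphic_assoc:
  assumes "M \<in> arr B X Y" "N \<in> arr B Y Z" "P \<in> arr B Z W"
  shows "isomorphic (hom_cat B X W) ((M \<odot> N) \<odot> P) (M \<odot> (N \<odot> P))"
  using hcomp_arr[OF hcomp_arr[OF assms(1,2)] assms(3)]
    hcomp_arr[OF assms(1) hcomp_arr[OF assms(2,3)]] assoc_iso[OF assms]
  by (rule isomorphic_hom_catI)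

lemma isomorphic_lunit:
  assumes "M \<in> arr B X Y"
  shows "isomorphic (hom_cat B X Y) (\<U> X \<odot> M) M"
  using hcomp_arr[OF unit_arr assms] arr_cells0[OF assms] assms lunit_iso[OF assms]
  by (intro isomorphic_hom_catI) simp_all

lemma isomorphic_runit:
  assumes "M \<in> arr B X Y"
  shows "isomorphic (hom_cat B X Y) (M \<odot> \<U> Y) M"
  using hcomp_arr[OF assms unit_arr] arr_cells0[OF assms] assms runit_iso[OF assms]
  by (intro isomorphic_hom_catI) simp_all

end

text \<open>Conjugating \<open>L\<close> by the equivalence gives \<open>N \<odot> L \<odot> M\<close>, which the intertwiner identifies with
  \<open>K\<close>; cyclicity says that conjugation does not change the shadow.\<close>

lemma (in shadowed_bicategory) shadow_isomorphic_of_intertwining: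
  assumes M: "M \<in> arr B R S" and N: "N \<in> arr B S R" and L: "L \<in> arr B R R" and K: "K \<in> arr B S S"
    and MN: "isomorphic (hom_cat B R R) (M \<odot> N) (\<U> R)"
    and NM: "isomorphic (hom_cat B S S) (\<U> S) (N \<odot> M)"
    and LK: "isomorphic (hom_cat B R S) (L \<odot> M) (M \<odot> K)"
  shows "isomorphic T (sh_ob Sh R L) (sh_ob Sh S K)"
proof -
  have RS: "R \<in> cells0 B" "S \<in> cells0 B"
    using arr_cells0[OF M] by auto
  interpret R: category "hom_cat B R R"
    using hom_category RS by blast
  interpret S: category "hom_cat B S S"
    using hom_category RS by blast
  have "isomorphic (hom_cat B R R) L (L \<odot> \<U> R)"
    using isomorphic_runit[OF L] by (rule R.isomorphic_sym)
  also have "isomorphic (hom_cat B R R) \<dots> (L \<odot> (M \<odot> N))"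
    using isomorphic_arr_refl[OF L] R.isomorphic_sym[OF MN] by (rule isomorphic_hcomp)
  also have "isomorphic (hom_cat B R R) \<dots> ((L \<odot> M) \<odot> N)"
    using isomorphic_assoc[OF L M N] by (rule R.isomorphic_sym)
  also have "isomorphic (hom_cat B R R) \<dots> ((M \<odot> K) \<odot> N)"
    using LK isomorphic_arr_refl[OF N] by (rule isomorphic_hcomp)
  finally have "isomorphic T (sh_ob Sh R L) (sh_ob Sh R ((M \<odot> K) \<odot> N))"
    using functor_isomorphic[OF sh_functor] RS by blast
  also have "isomorphic T \<dots> (sh_ob Sh S (N \<odot> (M \<odot> K)))"
  proof -
    have "(M \<odot> K) \<odot> N \<in> arr B R R" "N \<odot> (M \<odot> K) \<in> arr B S S"
      using M N K by (meson hcomp_arr)+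
    then have "sh_ob Sh R ((M \<odot> K) \<odot> N) \<in> Ob T" "sh_ob Sh S (N \<odot> (M \<odot> K)) \<in> Ob T"
      using sh_functor RS by (auto simp: is_functor_def hom_cat_def)
    then show ?thesis
      using theta_iso[OF hcomp_arr[OF M K] N] by (auto simp: isomorphic_def)
  qed
  also have "isomorphic T \<dots> (sh_ob Sh S K)"
  proof -
    have "isomorphic (hom_cat B S S) (N \<odot> (M \<odot> K)) ((N \<odot> M) \<odot> K)"
      using isomorphic_assoc[OF N M K] by (rule S.isomorphic_sym)
    also have "isomorphic (hom_cat B S S) \<dots> (\<U> S \<odot> K)"
      using S.isomorphic_sym[OF NM] isomorphic_arr_refl[OF K] by (rule isomorphic_hcomp)
    also have "isomorphic (hom_cat B S S) \<dots> K"
      using isomorphic_lunit[OF K] .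
    finally show ?thesis
      using functor_isomorphic[OF sh_functor] RS by blast
  qed
  finally show ?thesis .
qed

text \<open>Vertical composites and identities of twisted 2-cells are those of the underlying bicategory,
  so inverses may be computed there.\<close>

lemma isos2_tw_bicat_underlying:
  assumes "f \<in> isos2 (tw_bicat B G D) P Q"
  shows "f \<in> isos2 B (fst P) (fst Q)"
proof -
  have sub: "k \<in> cells2 B (fst P') (fst Q')" if "k \<in> cells2 (tw_bicat B G D) P' Q'" for k P' Q'
    using that by (simp add: tw_bicat_def tw_cells2_def split: prod.splits)
  have id: "ident (tw_bicat B G D) P' = \<ii>\<^bsub>B\<^esub> (fst P')" for P'
    by (simp add: tw_bicat_def split: prod.splits)
  have comp: "vcomp (tw_bicat B G D) = vcomp B"
    by (simp add: tw_bicat_def)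
  obtain f' where "f \<in> cells2 (tw_bicat B G D) P Q" "f' \<in> cells2 (tw_bicat B G D) Q P"
    "f' \<cdot>\<^bsub>B\<^esub> f = \<ii>\<^bsub>B\<^esub> (fst P)" "f \<cdot>\<^bsub>B\<^esub> f' = \<ii>\<^bsub>B\<^esub> (fst Q)"
    using assms by (auto simp: isos2_def isos_def is_inverse_def hom_cat_def id comp)
  then show ?thesis
    using sub[of f P Q] sub[of f' Q P]
    by (auto simp: isos2_def isos_def is_inverse_def hom_cat_def)
qed

lemma arr_tw_bicat:
  assumes "P \<in> arr (tw_bicat B G D) X Y"
  shows "fst P \<in> arr B X Y"
    and "\<forall>g\<in>carrier G. snd P g \<in> isos2 B (Theta D X g \<odot>\<^bsub>B\<^esub> fst P) (fst P \<odot>\<^bsub>B\<^esub> Theta D Y g)"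
  using assms by (auto simp: arr_def tw_bicat_def tw_cells1_def split: prod.splits)

lemma fst_tw_hcomp: "fst (hcomp (tw_bicat B G D) P Q) = fst P \<odot>\<^bsub>B\<^esub> fst Q"
  by (cases P; cases Q) (simp add: tw_bicat_def tw_hcomp_def Let_def)

lemma fst_tw_unit: "fst (unit1 (tw_bicat B G D) X) = unit1 B X"
  by (simp add: tw_bicat_def tw_unit_def)

theorem proposition4p17:
  fixes B :: "('o, 'm, 'c) bicat" and T :: "('x, 'y) cat"
    and Sh :: "('o, 'm, 'c, 'x, 'y) shadow"
    and G :: "'g monoid" and D :: "('o, 'g, 'm, 'c) twisting"
    and g :: 'g and R S :: 'o
  assumes "shadowed_bicategory B T Sh"
    and "twisting_data B G D"
    and "g \<in> carrier G"
    and "R \<in> cells0 B" and "S \<in> cells0 B"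
    and "G_morita_equivalent B G D R S"
  shows "isomorphic T
           (on_ob (twisted_shadow B G D Sh g R) (unit1 (tw_bicat B G D) R))
           (on_ob (twisted_shadow B G D Sh g S) (unit1 (tw_bicat B G D) S))"
proof -
  interpret shadowed_bicategory B T Sh by fact
  interpret twisting_data B G D by fact
  let ?k = "inv\<^bsub>G\<^esub> g"
  have k: "?k \<in> carrier G"
    using assms(3) by simp
  obtain P Q e c where P: "P \<in> arr (tw_bicat B G D) R S" and Q: "Q \<in> arr (tw_bicat B G D) S R"
    and e: "e \<in> isos2 (tw_bicat B G D) (unit1 (tw_bicat B G D) S) (hcomp (tw_bicat B G D) Q P)"
    and c: "c \<in> isos2 (tw_bicat B G D) (hcomp (tw_bicat B G D) P Q) (unit1 (tw_bicat B G D) R)"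
    using assms(6) unfolding G_morita_equivalent_def morita_equivalent_def by blast
  let ?M = "fst P" and ?N = "fst Q"
  have M: "?M \<in> arr B R S" and N: "?N \<in> arr B S R"
    using P Q by (simp_all add: arr_tw_bicat(1))
  have Theta: "Theta D X ?k \<in> arr B X X" if "X \<in> cells0 B" for X
    using Theta_Pic[OF that k] by (simp add: Pic_def invertible_arr_def)
  have NM: "isomorphic (hom_cat B S S) (unit1 B S) (?N \<odot>\<^bsub>B\<^esub> ?M)"
    using isos2_tw_bicat_underlying[OF e] unit_arr[OF assms(5)] hcomp_arr[OF N M]
    by (auto simp: fst_tw_hcomp fst_tw_unit intro: isomorphic_hom_catI)
  have MN: "isomorphic (hom_cat B R R) (?M \<odot>\<^bsub>B\<^esub> ?N) (unit1 B R)"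
    using isos2_tw_bicat_underlying[OF c] unit_arr[OF assms(4)] hcomp_arr[OF M N]
    by (auto simp: fst_tw_hcomp fst_tw_unit intro: isomorphic_hom_catI)
  have "isomorphic (hom_cat B R S) (Theta D R ?k \<odot>\<^bsub>B\<^esub> ?M) (?M \<odot>\<^bsub>B\<^esub> Theta D S ?k)"
    using hcomp_arr[OF Theta[OF assms(4)] M] hcomp_arr[OF M Theta[OF assms(5)]]
      arr_tw_bicat(2)[OF P, rule_format, OF k] by (rule isomorphic_hom_catI)
  then have main: "isomorphic T (sh_ob Sh R (Theta D R ?k)) (sh_ob Sh S (Theta D S ?k))"
    using M N Theta[OF assms(4)] Theta[OF assms(5)] MN NM
    by (intro shadow_isomorphic_of_intertwining)
  have unit: "isomorphic T (on_ob (twisted_shadow B G D Sh g X) (unit1 (tw_bicat B G D) X))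
      (sh_ob Sh X (Theta D X ?k))" if "X \<in> cells0 B" for X
    using functor_isomorphic[OF sh_functor[OF that] isomorphic_runit[OF Theta[OF that]]]
    by (simp add: twisted_shadow_def twist_arr_def tw_bicat_def tw_unit_def)
  show ?thesis
    using T.isomorphic_trans[OF T.isomorphic_trans[OF unit[OF assms(4)] main]
        T.isomorphic_sym[OF unit[OF assms(5)]]] .
qed

end
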